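(* For all integers $n\ge 3$ and $1<k<n$, we have $p(1,n)=p(n,n)>p(k,n)$.
   Context: Setting: $(R_1,\dots,R_n)$ is a uniformly random permutation of $(1,2,\dots,n)$ ($R_j$ is the absolute rank of the $j$-th candidate, rank 1 being the best), and $X_j=|\{1\le i\le j: R_i\le R_j\}|$ is the relative rank of the $j$-th candidate among the first $j$. $\mathcal{F}_j$ is the $\sigma$-algebra generated by $X_1,\dots,X_j$, and $\mathcal{M}_n$ is the set of all stopping rules with values in $\{1,\dots,n\}$ adapted to $\{\mathcal{F}_j\}$. For $1\le k\le n$, $$p(k,n):=\sup_{\tau\in\mathcal{M}_n}P(R_\tau=k),$$ the maximum probability of selecting the $k$-th best of $n$ candidates. *)

theory Defs
  imports
    "HOL-Probability.Probability"
    "HOL-Combinatorics.Permutations"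
begin

text \<open>
  The underlying space consists of the permutations of \<open>{1..n}\<close> with the uniform distribution,
  and the random permutation is the identity map: \<open>R\<^sub>j(\<pi>) = \<pi> j\<close>.
\<close>

definition rank_perms :: "nat \<Rightarrow> (nat \<Rightarrow> nat) set" where
  "rank_perms n = {\<pi>. \<pi> permutes {1..n}}"

definition rank_measure :: "nat \<Rightarrow> (nat \<Rightarrow> nat) measure" where
  "rank_measure n = uniform_count_measure (rank_perms n)"

definition rel_rank :: "nat \<Rightarrow> (nat \<Rightarrow> nat) \<Rightarrow> nat" where
  "rel_rank j \<pi> = card {i \<in> {1..j}. \<pi> i \<le> \<pi> j}"

text \<open>
  The library's stopping times are indexed by the whole type \<open>nat\<close>, hence the filtration is
  extended to all indices: it is trivial at \<open>0\<close> and constant from index \<open>n\<close> on.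
\<close>

definition rank_filtration :: "nat \<Rightarrow> nat \<Rightarrow> (nat \<Rightarrow> nat) measure" where
  "rank_filtration n j =
     sigma (rank_perms n) {rel_rank i -` B \<inter> rank_perms n |i B. i \<in> {1..min j n}}"

definition stopping_rules :: "nat \<Rightarrow> ((nat \<Rightarrow> nat) \<Rightarrow> nat) set" where
  "stopping_rules n = {\<tau> \<in> rank_perms n \<rightarrow> {1..n}. stopping_time (rank_filtration n) \<tau>}"

definition select_prob :: "nat \<Rightarrow> nat \<Rightarrow> real" where
  "select_prob k n =
     (SUP \<tau>\<in>stopping_rules n.
        measure (rank_measure n) {\<pi> \<in> space (rank_measure n). \<pi> (\<tau> \<pi>) = k})"

lemma finite_rank_perms: "finite (rank_perms n)"
  unfolding rank_perms_def by (rule finite_permutations) simp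

lemma rank_perms_nonempty: "rank_perms n \<noteq> {}"
  unfolding rank_perms_def using permutes_id by blast

lemma prob_space_rank_measure: "prob_space (rank_measure n)"
  unfolding rank_measure_def
  by (intro prob_space_uniform_count_measure finite_rank_perms rank_perms_nonempty)

lemma sets_rank_filtration:
  "sets (rank_filtration n j) =
     sigma_sets (rank_perms n) {rel_rank i -` B \<inter> rank_perms n |i B. i \<in> {1..min j n}}"
  unfolding rank_filtration_def by (rule sets_measure_of) auto

lemma filtration_rank_filtration: "filtration (rank_perms n) (rank_filtration n)"
proof
  show "space (rank_filtration n j) = rank_perms n" for j
    unfolding rank_filtration_def by (rule space_measure_of) auto
  show "sets (rank_filtration n i) \<le> sets (rank_filtration n j)" if "i \<le> j" for i j
    unfolding sets_rank_filtration using that by (intro sigma_sets_mono') fastforce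
qed

text \<open>
  The supremum defining \<^const>\<open>select_prob\<close> is taken over a nonempty bounded set of reals.
\<close>

lemma stopping_rules_nonempty: "n \<ge> 1 \<Longrightarrow> stopping_rules n \<noteq> {}"
  unfolding stopping_rules_def using stopping_time_const[of "rank_filtration n" 1] by fastforce

lemma bdd_above_select_prob:
  "bdd_above ((\<lambda>\<tau>. measure (rank_measure n) {\<pi> \<in> space (rank_measure n). \<pi> (\<tau> \<pi>) = k})
     ` stopping_rules n)"
  using prob_space.prob_le_1[OF prob_space_rank_measure] by (intro bdd_aboveI2) blast

end

theory Submission
  imports Defs
begin

text \<open>
  Let \<open>W\<^sub>j\<close> be an upper bound for the success probability after \<open>j\<close> candidates have been rejected.
  Given \<open>X\<^sub>1, \<dots>, X\<^sub>j\<close>, the rank \<open>R\<^sub>j\<^sub>+\<^sub>1\<close> is uniform on \<open>{1..n}\<close> and \<open>X\<^sub>j\<^sub>+\<^sub>1\<close> is uniform on \<open>{1..j+1}\<close>.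
  Hence stopping at \<open>j + 1\<close> yields conditional success probability at most \<open>1/n\<close> in total, and has
  conditional probability either \<open>0\<close> or at least \<open>1/(j+1)\<close>. So for every target rank \<open>k\<close> one may take
  \<open>W\<^sub>j = W\<^sub>j\<^sub>+\<^sub>1 + max 0 (1/n - W\<^sub>j\<^sub>+\<^sub>1/(j+1))\<close> with \<open>W\<^sub>n = 0\<close>. For \<open>k = 1\<close> and \<open>k = n\<close> the event \<open>R\<^sub>j = k\<close>
  forces a single value of \<open>X\<^sub>j\<close>, and the rule that stops at this value whenever it is profitable attains
  the bound. For \<open>1 < k < n\<close> the event \<open>R\<^sub>n\<^sub>-\<^sub>1 = k\<close> is compatible with \<open>X\<^sub>n\<^sub>-\<^sub>1 = k - 1\<close> and with \<open>X\<^sub>n\<^sub>-\<^sub>1 = k\<close>,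
  so the bound at stage \<open>n - 2\<close> can be lowered by \<open>1/(n(n-1))\<close>; since the recursion is strictly monotone
  (apart from the harmless first stage), the loss persists down to \<open>W\<^sub>0\<close>.
\<close>

section \<open>Coding permutations by relative ranks\<close>

lemma rel_rank_bounds:
  assumes "j \<ge> 1"
  shows "rel_rank j \<pi> \<in> {1..j}"
proof -
  have "card {i \<in> {1..j}. \<pi> i \<le> \<pi> j} \<le> card {1..j}"
    by (intro card_mono) auto
  moreover have "card {i \<in> {1..j}. \<pi> i \<le> \<pi> j} > 0"
    unfolding card_gt_0_iff using assms by auto
  ultimately show ?thesis
    unfolding rel_rank_def atLeastAtMost_iff card_atLeastAtMost by linarith
qed

text \<open>Counting values instead of positions shows that a relative rank depends only on the set
  of the first \<open>j\<close> values and on \<open>\<pi> j\<close>.\<close>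

lemma rel_rank_eq_card_image:
  assumes "inj \<pi>"
  shows "rel_rank j \<pi> = card {v \<in> \<pi> ` {1..j}. v \<le> \<pi> j}"
proof -
  have "{v \<in> \<pi> ` {1..j}. v \<le> \<pi> j} = \<pi> ` {i \<in> {1..j}. \<pi> i \<le> \<pi> j}"
    by auto
  then show ?thesis
    unfolding rel_rank_def using assms by (simp add: card_image inj_on_subset)
qed

text \<open>
  Going backwards from \<open>n\<close>, the value \<open>\<pi> j\<close> is the \<open>rel_rank j \<pi>\<close>-th smallest of the values
  not taken after \<open>j\<close>.
\<close>

lemma inj_on_rel_ranks:
  "inj_on (\<lambda>\<pi>. \<lambda>i\<in>{1..n}. rel_rank i \<pi>) (rank_perms n)"
proof (rule inj_onI)
  fix \<pi> \<sigma> assume E: "\<pi> \<in> rank_perms n" "\<sigma> \<in> rank_perms n"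
    and eq: "(\<lambda>i\<in>{1..n}. rel_rank i \<pi>) = (\<lambda>i\<in>{1..n}. rel_rank i \<sigma>)"
  have p: "\<pi> permutes {1..n}" "\<sigma> permutes {1..n}"
    using E by (auto simp: rank_perms_def)
  have inj: "inj \<pi>" "inj \<sigma>" and bij: "bij \<pi>" "bij \<sigma>"
    using p permutes_inj permutes_bij by auto
  have ranks: "rel_rank i \<pi> = rel_rank i \<sigma>" if "i \<in> {1..n}" for i
    using fun_cong[OF eq, of i] that by simp
  have "\<forall>i. i \<notin> {1..m} \<longrightarrow> \<pi> i = \<sigma> i" if "m \<le> n" for m
    using that
  proof (induction m rule: inc_induct)
    case base
    show ?case using p by (metis permutes_not_in)
  next
    case (step m)
    \<comment> \<open>Agreement beyond \<open>Suc m\<close> and bijectivity force the same set of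
      first \<open>Suc m\<close> values, in which equal relative ranks pick the same
      element.\<close>
    have "\<pi> ` (- {1..Suc m}) = \<sigma> ` (- {1..Suc m})"
      using step by (intro image_cong) auto
    then have T: "\<pi> ` {1..Suc m} = \<sigma> ` {1..Suc m}"
      using bij by (metis bij_image_Compl_eq double_complement)
    define T where "T = \<pi> ` {1..Suc m}"
    have rT: "card {v \<in> T. v \<le> \<pi> (Suc m)} = card {v \<in> T. v \<le> \<sigma> (Suc m)}"
      using ranks[of "Suc m"] step rel_rank_eq_card_image[OF inj(1), of "Suc m"]
        rel_rank_eq_card_image[OF inj(2), of "Suc m"] T unfolding T_def by simp
    have less: "card {v \<in> T. v \<le> a} < card {v \<in> T. v \<le> b}" if "a < b" "b \<in> T" for a b
    proof (rule psubset_card_mono)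
      have "b \<in> {v \<in> T. v \<le> b}" "b \<notin> {v \<in> T. v \<le> a}" "{v \<in> T. v \<le> a} \<subseteq> {v \<in> T. v \<le> b}"
        using that by auto
      then show "{v \<in> T. v \<le> a} \<subset> {v \<in> T. v \<le> b}"
        by blast
    qed (simp add: T_def)
    have "\<pi> (Suc m) \<in> T" "\<sigma> (Suc m) \<in> T"
      using T by (auto simp: T_def)
    then have "\<pi> (Suc m) = \<sigma> (Suc m)"
      using less[of "\<pi> (Suc m)" "\<sigma> (Suc m)"] less[of "\<sigma> (Suc m)" "\<pi> (Suc m)"] rT
      by (cases "\<pi> (Suc m)" "\<sigma> (Suc m)" rule: linorder_cases) simp_all
    moreover have "i = Suc m" if "i \<notin> {1..m}" "i \<in> {1..Suc m}" for i
      using that by auto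
    ultimately show ?case using step by blast
  qed
  from this[of 0] show "\<pi> = \<sigma>" by auto
qed

text \<open>The coding is injective and both sides have \<open>fact n\<close> elements. Hence the
  relative ranks are independent, the \<open>i\<close>-th being uniform on
  \<open>{1..i}\<close>.\<close>

lemma rel_ranks_image:
  "(\<lambda>\<pi>. \<lambda>i\<in>{1..n}. rel_rank i \<pi>) ` rank_perms n = (\<Pi>\<^sub>E i\<in>{1..n}. {1..i})"
proof (rule card_subset_eq)
  show "finite (\<Pi>\<^sub>E i\<in>{1..n}. {1..i})"
    by (intro finite_PiE) auto
  show "(\<lambda>\<pi>. \<lambda>i\<in>{1..n}. rel_rank i \<pi>) ` rank_perms n \<subseteq> (\<Pi>\<^sub>E i\<in>{1..n}. {1..i})"
    using rel_rank_bounds by (auto simp: PiE_iff)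
  show "card ((\<lambda>\<pi>. \<lambda>i\<in>{1..n}. rel_rank i \<pi>) ` rank_perms n) = card (\<Pi>\<^sub>E i\<in>{1..n}. {1..i})"
    unfolding card_image[OF inj_on_rel_ranks] using card_permutations[of "{1..n}" n]
    by (simp add: card_PiE rank_perms_def fact_prod)
qed

section \<open>Atoms of the filtration\<close>

text \<open>When nonempty, these are the atoms of the sigma-algebra of the first \<open>j\<close>
  relative ranks; counting inside them replaces conditioning.\<close>

definition rank_atom :: "nat \<Rightarrow> nat \<Rightarrow> (nat \<Rightarrow> nat) \<Rightarrow> (nat \<Rightarrow> nat) set" where
  "rank_atom n j x = {\<pi> \<in> rank_perms n. \<forall>i\<in>{1..j}. rel_rank i \<pi> = x i}"

lemma finite_rank_atom [simp]: "finite (rank_atom n j x)"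
  unfolding rank_atom_def using finite_rank_perms by simp

lemma rank_atom_Suc: "rank_atom n (Suc j) x = {\<pi> \<in> rank_atom n j x. rel_rank (Suc j) \<pi> = x (Suc j)}"
  unfolding rank_atom_def by (auto simp: le_Suc_eq)

lemma rank_atom_upd: "rank_atom n j (x(Suc j := y)) = rank_atom n j x"
  unfolding rank_atom_def by auto

text \<open>In the coding by relative ranks the first \<open>j\<close> coordinates are frozen, and
  each later coordinate \<open>i\<close> ranges freely over \<open>{1..i}\<close>.\<close>

lemma card_rank_atom:
  assumes "j \<le> n" "\<And>i. i \<in> {1..j} \<Longrightarrow> x i \<in> {1..i}"
  shows "card (rank_atom n j x) = \<Prod>{Suc j..n}"
proof -
  let ?c = "\<lambda>\<pi>. \<lambda>i\<in>{1..n}. rel_rank i \<pi>"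
  let ?B = "\<lambda>i. if i \<le> j then {x i} else {1..i}"
  have "?c ` rank_atom n j x = (\<Pi>\<^sub>E i\<in>{1..n}. ?B i)"
  proof (intro equalityI subsetI)
    fix f assume "f \<in> ?c ` rank_atom n j x"
    then show "f \<in> (\<Pi>\<^sub>E i\<in>{1..n}. ?B i)"
      using rel_rank_bounds by (auto simp: PiE_iff rank_atom_def)
  next
    fix f assume f: "f \<in> (\<Pi>\<^sub>E i\<in>{1..n}. ?B i)"
    have "f \<in> (\<Pi>\<^sub>E i\<in>{1..n}. {1..i})"
    proof (rule PiE_I)
      fix i assume "i \<in> {1..n}"
      then show "f i \<in> {1..i}"
        using PiE_mem[OF f, of i] assms(2)[of i] by (auto split: if_splits)
    qed (use f in \<open>auto simp: PiE_iff extensional_def\<close>)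
    then obtain \<pi> where \<pi>: "\<pi> \<in> rank_perms n" "f = ?c \<pi>"
      using rel_ranks_image by (metis (no_types, lifting) imageE)
    have "rel_rank i \<pi> = x i" if "i \<in> {1..j}" for i
      using PiE_mem[OF f, of i] that assms(1) \<pi>(2) by auto
    then show "f \<in> ?c ` rank_atom n j x"
      using \<pi> by (auto simp: rank_atom_def)
  qed
  moreover have "inj_on ?c (rank_atom n j x)"
    using inj_on_rel_ranks by (rule inj_on_subset) (auto simp: rank_atom_def)
  ultimately have "card (rank_atom n j x) = card (\<Pi>\<^sub>E i\<in>{1..n}. ?B i)"
    by (metis card_image)
  also have "\<dots> = (\<Prod>i\<in>{1..n}. if i \<le> j then 1 else i)"
    by (subst card_PiE) (auto intro: prod.cong)
  also have "\<dots> = \<Prod>{Suc j..n}"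
    by (rule prod.mono_neutral_cong_right) auto
  finally show ?thesis .
qed

text \<open>Given the past, the next relative rank is uniform: each admissible value takes the same
  share of the atom.\<close>

lemma card_rank_atom_Suc:
  assumes "j < n" "\<And>i. i \<in> {1..Suc j} \<Longrightarrow> x i \<in> {1..i}"
  shows "card (rank_atom n j x) = Suc j * card (rank_atom n (Suc j) x)"
proof -
  have "card (rank_atom n j x) = \<Prod>{Suc j..n}"
    using assms by (intro card_rank_atom) auto
  moreover have "card (rank_atom n (Suc j) x) = \<Prod>{Suc (Suc j)..n}"
    using assms by (intro card_rank_atom) auto
  ultimately show ?thesis
    using assms(1) by (simp add: prod.atLeast_Suc_atMost)
qed

lemma card_rank_atom_pos:
  assumes "j \<le> n" "\<And>i. i \<in> {1..j} \<Longrightarrow> x i \<in> {1..i}"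
  shows "card (rank_atom n j x) > 0"
  using card_rank_atom[OF assms] by (simp add: prod_pos)

section \<open>Conditional law of the next absolute rank\<close>

text \<open>
  Exchanging the values \<open>v\<close> and \<open>v + 1\<close> does not affect the relative order of the first \<open>j\<close> values
  if one of the two exchanged values sits at a later position.
\<close>

lemma rel_rank_transpose:
  assumes "inj \<pi>" "\<pi> (Suc j) \<in> {v, Suc v}" "i \<le> j"
  shows "rel_rank i (Transposition.transpose v (Suc v) \<circ> \<pi>) = rel_rank i \<pi>"
proof -
  obtain w where w: "\<pi> (Suc j) = w" "w = v \<or> w = Suc v"
    using assms(2) by auto
  have ne: "\<pi> l \<noteq> w" if "l \<le> j" for l
    using injD[OF assms(1), of l "Suc j"] w(1) that by auto
  have "Transposition.transpose v (Suc v) (\<pi> l) \<le> Transposition.transpose v (Suc v) (\<pi> i) \<longleftrightarrow> \<pi> l \<le> \<pi> i" if "l \<le> j" for l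
    using ne[OF that] ne[OF assms(3)] w(2) unfolding Transposition.transpose_def by auto
  then have "{l \<in> {1..i}. Transposition.transpose v (Suc v) (\<pi> l) \<le> Transposition.transpose v (Suc v) (\<pi> i)} = {l \<in> {1..i}. \<pi> l \<le> \<pi> i}"
    using assms(3) by auto
  then show ?thesis
    unfolding rel_rank_def by simp
qed

text \<open>Composition with the transposition is an involution that stays inside the atom and
  exchanges the two sets.\<close>

lemma card_rank_atom_value_Suc:
  assumes "v \<in> {1..<n}"
  shows "card {\<pi> \<in> rank_atom n j x. \<pi> (Suc j) = Suc v} = card {\<pi> \<in> rank_atom n j x. \<pi> (Suc j) = v}"
proof -
  let ?t = "\<lambda>\<pi>::nat\<Rightarrow>nat. Transposition.transpose v (Suc v) \<circ> \<pi>"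
  have inv: "?t (?t \<pi>) = \<pi>" for \<pi>
    by (simp add: fun_eq_iff)
  have atom: "?t \<pi> \<in> rank_atom n j x" if "\<pi> \<in> rank_atom n j x" "\<pi> (Suc j) \<in> {v, Suc v}" for \<pi>
  proof -
    have p: "\<pi> permutes {1..n}" using that by (auto simp: rank_atom_def rank_perms_def)
    moreover have "Transposition.transpose v (Suc v) permutes {1..n}"
      using assms by (intro permutes_swap_id) auto
    ultimately have "?t \<pi> permutes {1..n}"
      by (rule permutes_compose)
    then show ?thesis
      using that rel_rank_transpose[OF permutes_inj[OF p] that(2)]
      by (auto simp: rank_atom_def rank_perms_def)
  qed
  have "bij_betw ?t {\<pi> \<in> rank_atom n j x. \<pi> (Suc j) = Suc v} {\<pi> \<in> rank_atom n j x. \<pi> (Suc j) = v}"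
    by (rule bij_betw_byWitness[where f' = ?t]) (use inv atom in auto)
  then show ?thesis by (rule bij_betw_same_card)
qed

text \<open>Neighbouring values are equally frequent, hence all \<open>n\<close> values are, and
  they partition the atom: given the past, the next absolute rank is uniform.\<close>

lemma card_rank_atom_value:
  assumes "j < n" "k \<in> {1..n}"
  shows "n * card {\<pi> \<in> rank_atom n j x. \<pi> (Suc j) = k} = card (rank_atom n j x)"
proof -
  let ?K = "\<lambda>v. {\<pi> \<in> rank_atom n j x. \<pi> (Suc j) = v}"
  have const: "card (?K v) = card (?K 1)" if "1 \<le> v" "v \<le> n" for v
    using that
  proof (induction v rule: dec_induct)
    case (step m)
    then show ?case using card_rank_atom_value_Suc[of m n j x] by simp
  qed simp
  have "\<pi> (Suc j) \<in> {1..n}" if "\<pi> \<in> rank_atom n j x" for \<pi>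
    using that assms(1) permutes_in_image[of \<pi> "{1..n}" "Suc j"]
    by (auto simp: rank_atom_def rank_perms_def)
  then have "rank_atom n j x = (\<Union>v\<in>{1..n}. ?K v)"
    by auto
  then have "card (rank_atom n j x) = card (\<Union>v\<in>{1..n}. ?K v)"
    by simp
  also have "\<dots> = (\<Sum>v\<in>{1..n}. card (?K v))"
    by (intro card_UN_disjoint) auto
  also have "\<dots> = (\<Sum>v\<in>{1..n}. card (?K k))"
  proof (rule sum.cong)
    show "card (?K v) = card (?K k)" if "v \<in> {1..n}" for v
      using const[of v] const[of k] that assms(2) by simp
  qed simp
  finally show ?thesis by simp
qed

section \<open>Measurability as saturation by atoms\<close>

definition rank_saturated :: "nat \<Rightarrow> nat \<Rightarrow> (nat \<Rightarrow> nat) set \<Rightarrow> bool" where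
  "rank_saturated n j A \<longleftrightarrow> A \<subseteq> rank_perms n \<and> (\<forall>\<pi>\<in>A. rank_atom n j (\<lambda>i. rel_rank i \<pi>) \<subseteq> A)"

lemma rank_saturated_Int_atom:
  assumes "rank_saturated n i A" "j \<le> i"
  shows "rank_saturated n i (rank_atom n j x \<inter> A)"
  unfolding rank_saturated_def
proof (intro conjI ballI)
  show "rank_atom n j x \<inter> A \<subseteq> rank_perms n"
    using assms(1) unfolding rank_saturated_def by blast
next
  fix \<pi> assume \<pi>: "\<pi> \<in> rank_atom n j x \<inter> A"
  show "rank_atom n i (\<lambda>i. rel_rank i \<pi>) \<subseteq> rank_atom n j x \<inter> A"
  proof
    fix \<sigma> assume \<sigma>: "\<sigma> \<in> rank_atom n i (\<lambda>i. rel_rank i \<pi>)"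
    with \<pi> have "\<sigma> \<in> A"
      using assms(1) unfolding rank_saturated_def by blast
    moreover have "rel_rank l \<sigma> = x l" if "l \<in> {1..j}" for l
      using \<pi> \<sigma> assms(2) that by (auto simp: rank_atom_def)
    ultimately show "\<sigma> \<in> rank_atom n j x \<inter> A"
      using \<sigma> by (auto simp: rank_atom_def)
  qed
qed

lemma rank_saturated_sets:
  assumes "A \<in> sets (rank_filtration n j)" "j \<le> n"
  shows "rank_saturated n j A"
proof -
  let ?r = "\<lambda>\<pi> \<sigma>. \<forall>i\<in>{1..j}. rel_rank i \<sigma> = rel_rank i \<pi>"
  \<comment> \<open>As an equivalence symmetric in the two permutations, the claim passes to
    complements at once.\<close>
  have "A \<subseteq> rank_perms n \<and> (\<forall>\<pi>\<in>rank_perms n. \<forall>\<sigma>\<in>rank_perms n. ?r \<pi> \<sigma> \<longrightarrow> (\<pi> \<in> A \<longleftrightarrow> \<sigma> \<in> A))"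
    using assms(1) unfolding sets_rank_filtration
  proof (induction rule: sigma_sets.induct)
    case (Basic a)
    then obtain i B where a: "a = rel_rank i -` B \<inter> rank_perms n" and i: "i \<in> {1..j}"
      using assms(2) by auto
    have "\<pi> \<in> a \<longleftrightarrow> \<sigma> \<in> a" if "\<pi> \<in> rank_perms n" "\<sigma> \<in> rank_perms n" "?r \<pi> \<sigma>" for \<pi> \<sigma>
      using bspec[OF that(3) i] that(1,2) by (simp add: a)
    then show ?case using a by blast
  next
    case (Compl a)
    then show ?case by blast
  next
    case (Union a)
    show ?case
    proof (intro conjI ballI impI)
      show "(\<Union>i. a i) \<subseteq> rank_perms n"
        using Union.IH by blast
      fix \<pi> \<sigma> assume r: "\<pi> \<in> rank_perms n" "\<sigma> \<in> rank_perms n" "?r \<pi> \<sigma>"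
      have "\<pi> \<in> a i \<longleftrightarrow> \<sigma> \<in> a i" for i
        using r by (rule conjunct2[OF Union.IH[of i], THEN bspec, THEN bspec, THEN mp])
      then show "\<pi> \<in> (\<Union>i. a i) \<longleftrightarrow> \<sigma> \<in> (\<Union>i. a i)"
        by simp
    qed
  qed simp
  then show ?thesis
    unfolding rank_saturated_def rank_atom_def by blast
qed

text \<open>\<open>A\<close> is a disjoint union of whole atoms, so a sign known on each atom
  carries over; this plays the role of the tower property.\<close>

lemma sum_saturated_le_0:
  fixes f :: "(nat \<Rightarrow> nat) \<Rightarrow> real"
  assumes sat: "rank_saturated n j A"
    and le: "\<And>\<pi>. \<pi> \<in> A \<Longrightarrow> (\<Sum>\<sigma>\<in>rank_atom n j (\<lambda>i. rel_rank i \<pi>). f \<sigma>) \<le> 0"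
  shows "(\<Sum>\<pi>\<in>A. f \<pi>) \<le> 0"
proof -
  let ?c = "\<lambda>\<pi>. \<lambda>i\<in>{1..j}. rel_rank i \<pi>"
  have "finite A"
    using sat finite_rank_perms finite_subset unfolding rank_saturated_def by blast
  then have "(\<Sum>\<pi>\<in>A. f \<pi>) = (\<Sum>y\<in>?c ` A. \<Sum>\<sigma>\<in>{\<sigma> \<in> A. ?c \<sigma> = y}. f \<sigma>)"
    by (rule sum.image_gen)
  also have "\<dots> \<le> 0"
  proof (rule sum_nonpos)
    fix y assume "y \<in> ?c ` A"
    then obtain \<pi> where \<pi>: "\<pi> \<in> A" "y = ?c \<pi>" by auto
    have "?c \<sigma> = ?c \<pi> \<longleftrightarrow> (\<forall>i\<in>{1..j}. rel_rank i \<sigma> = rel_rank i \<pi>)" for \<sigma>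
      by (auto simp: fun_eq_iff restrict_def)
    then have "{\<sigma> \<in> A. ?c \<sigma> = y} = rank_atom n j (\<lambda>i. rel_rank i \<pi>)"
      using sat \<pi> unfolding rank_saturated_def rank_atom_def by blast
    then show "(\<Sum>\<sigma>\<in>{\<sigma> \<in> A. ?c \<sigma> = y}. f \<sigma>) \<le> 0"
      using le[OF \<pi>(1)] by simp
  qed
  finally show ?thesis .
qed

section \<open>Telescoping along a stopping rule\<close>

text \<open>Increment of a value process, where \<open>W j\<close> is the value assigned to having
  rejected \<open>j\<close> candidates; it is meaningful on paths with
  \<open>j < \<tau> \<pi>\<close>.\<close>

definition stage_gain :: "(nat \<Rightarrow> real) \<Rightarrow> nat \<Rightarrow> ((nat \<Rightarrow> nat) \<Rightarrow> nat) \<Rightarrow> nat \<Rightarrow> (nat \<Rightarrow> nat) \<Rightarrow> real" where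
  "stage_gain W k \<tau> j \<pi> = (if \<tau> \<pi> = Suc j then of_bool (\<pi> (Suc j) = k) else W (Suc j)) - W j"

lemma sum_stage_gain:
  fixes W :: "nat \<Rightarrow> real"
  assumes "finite A"
  shows "(\<Sum>\<pi>\<in>A. stage_gain W k \<tau> j \<pi>) =
    card {\<pi> \<in> {\<pi> \<in> A. \<tau> \<pi> = Suc j}. \<pi> (Suc j) = k}
    + W (Suc j) * (real (card A) - card {\<pi> \<in> A. \<tau> \<pi> = Suc j}) - W j * card A"
proof -
  have "stage_gain W k \<tau> j \<pi> = of_bool (\<tau> \<pi> = Suc j \<and> \<pi> (Suc j) = k)
      + W (Suc j) * (1 - of_bool (\<tau> \<pi> = Suc j)) - W j" for \<pi>
    unfolding stage_gain_def by auto
  moreover have "A \<inter> {\<pi>. \<tau> \<pi> = Suc j \<and> \<pi> (Suc j) = k} = {\<pi> \<in> {\<pi> \<in> A. \<tau> \<pi> = Suc j}. \<pi> (Suc j) = k}"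
    "A \<inter> {\<pi>. \<tau> \<pi> = Suc j} = {\<pi> \<in> A. \<tau> \<pi> = Suc j}"
    by auto
  ultimately show ?thesis
    using assms by (simp add: sum_subtractf sum.distrib sum_distrib_left[symmetric] sum_of_bool_eq)
qed

text \<open>Along each path the gains up to stopping telescope to the reward minus
  \<open>W 0\<close>. Being an identity, it serves both the upper bound and the optimality of the
  record rule.\<close>

lemma card_success_telescope:
  fixes W :: "nat \<Rightarrow> real"
  assumes "\<tau> \<in> rank_perms n \<rightarrow> {1..n}"
  shows "real (card {\<pi> \<in> rank_perms n. \<pi> (\<tau> \<pi>) = k}) =
    W 0 * fact n + (\<Sum>j<n. \<Sum>\<pi>\<in>{\<pi> \<in> rank_perms n. j < \<tau> \<pi>}. stage_gain W k \<tau> j \<pi>)"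
proof -
  have point: "(\<Sum>j\<in>{j \<in> {..<n}. j < \<tau> \<pi>}. stage_gain W k \<tau> j \<pi>) = of_bool (\<pi> (\<tau> \<pi>) = k) - W 0"
    if \<pi>: "\<pi> \<in> rank_perms n" for \<pi>
  proof -
    obtain s where s: "\<tau> \<pi> = Suc s" "Suc s \<le> n"
      using funcset_mem[OF assms \<pi>] by (cases "\<tau> \<pi>") auto
    then have "{j \<in> {..<n}. j < \<tau> \<pi>} = {..<Suc s}"
      by auto
    then have "(\<Sum>j\<in>{j \<in> {..<n}. j < \<tau> \<pi>}. stage_gain W k \<tau> j \<pi>) =
        (\<Sum>j<s. W (Suc j) - W j) + (of_bool (\<pi> (Suc s) = k) - W s)"
      using s by (simp add: stage_gain_def)
    then show ?thesis
      using s by (simp add: sum_lessThan_telescope)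
  qed
  have "(\<Sum>j<n. \<Sum>\<pi>\<in>{\<pi> \<in> rank_perms n. j < \<tau> \<pi>}. stage_gain W k \<tau> j \<pi>) =
      (\<Sum>\<pi>\<in>rank_perms n. \<Sum>j\<in>{j \<in> {..<n}. j < \<tau> \<pi>}. stage_gain W k \<tau> j \<pi>)"
    by (rule sum.swap_restrict) (auto simp: finite_rank_perms)
  also have "\<dots> = (\<Sum>\<pi>\<in>rank_perms n. of_bool (\<pi> (\<tau> \<pi>) = k) - W 0)"
    using point by (intro sum.cong) auto
  also have "\<dots> = card {\<pi> \<in> rank_perms n. \<pi> (\<tau> \<pi>) = k} - W 0 * card (rank_perms n)"
    by (simp add: sum_subtractf sum_of_bool_eq finite_rank_perms Collect_conj_eq)
  also have "card (rank_perms n) = fact n"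
    unfolding rank_perms_def by (rule card_permutations) auto
  finally show ?thesis by simp
qed

lemma stopping_rule_saturated:
  assumes "\<tau> \<in> stopping_rules n" "j \<le> n"
  shows "rank_saturated n j {\<pi> \<in> rank_perms n. \<tau> \<pi> \<le> j}"
    and "rank_saturated n j {\<pi> \<in> rank_perms n. j < \<tau> \<pi>}"
proof -
  have sp: "space (rank_filtration n j) = rank_perms n"
    using filtration_rank_filtration by (rule filtration.space_F)
  have st: "{\<pi> \<in> rank_perms n. \<tau> \<pi> \<le> j} \<in> sets (rank_filtration n j)"
    using assms(1) unfolding stopping_rules_def stopping_time_def pred_def sp[symmetric] by auto
  then show "rank_saturated n j {\<pi> \<in> rank_perms n. \<tau> \<pi> \<le> j}"
    using assms(2) by (rule rank_saturated_sets)
  have "rank_perms n - {\<pi> \<in> rank_perms n. \<tau> \<pi> \<le> j} = {\<pi> \<in> rank_perms n. j < \<tau> \<pi>}"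
    by auto
  then have "{\<pi> \<in> rank_perms n. j < \<tau> \<pi>} \<in> sets (rank_filtration n j)"
    using sets.compl_sets[OF st] sp by simp
  then show "rank_saturated n j {\<pi> \<in> rank_perms n. j < \<tau> \<pi>}"
    using assms(2) by (rule rank_saturated_sets)
qed

text \<open>Verification principle: if no set \<open>C\<close> of stops inside an atom beats
  \<open>W\<close> in a single step, every stage sum in the telescope is at most 0.\<close>

lemma card_success_le:
  fixes W :: "nat \<Rightarrow> real"
  assumes \<tau>: "\<tau> \<in> stopping_rules n"
    and step: "\<And>j x C. j < n \<Longrightarrow> (\<And>i. i \<in> {1..n} \<Longrightarrow> x i \<in> {1..i}) \<Longrightarrow> C \<subseteq> rank_atom n j x \<Longrightarrow>
      rank_saturated n (Suc j) C \<Longrightarrow>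
      card {\<pi> \<in> C. \<pi> (Suc j) = k} + W (Suc j) * (real (card (rank_atom n j x)) - card C)
        \<le> W j * card (rank_atom n j x)"
  shows "card {\<pi> \<in> rank_perms n. \<pi> (\<tau> \<pi>) = k} \<le> W 0 * fact n"
proof -
  have stage: "(\<Sum>\<pi>\<in>{\<pi> \<in> rank_perms n. j < \<tau> \<pi>}. stage_gain W k \<tau> j \<pi>) \<le> 0" if j: "j < n" for j
  proof (rule sum_saturated_le_0)
    show sat: "rank_saturated n j {\<pi> \<in> rank_perms n. j < \<tau> \<pi>}"
      using \<tau> j by (intro stopping_rule_saturated) auto
    fix \<pi> assume \<pi>: "\<pi> \<in> {\<pi> \<in> rank_perms n. j < \<tau> \<pi>}"
    let ?x = "\<lambda>i. rel_rank i \<pi>" and ?C = "\<lambda>A. {\<sigma> \<in> A. \<tau> \<sigma> = Suc j}"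
    let ?A = "rank_atom n j ?x"
    have "?A \<subseteq> {\<pi> \<in> rank_perms n. j < \<tau> \<pi>}"
      using sat \<pi> unfolding rank_saturated_def by blast
    \<comment> \<open>All of the atom continues past \<open>j\<close>, so stopping exactly at
      \<open>Suc j\<close> is stopping by \<open>Suc j\<close>, an event of the next
      sigma-algebra.\<close>
    then have C: "?C ?A = ?A \<inter> {\<pi> \<in> rank_perms n. \<tau> \<pi> \<le> Suc j}"
      by fastforce
    have "rank_saturated n (Suc j) {\<pi> \<in> rank_perms n. \<tau> \<pi> \<le> Suc j}"
      using \<tau> j by (intro stopping_rule_saturated) auto
    then have "rank_saturated n (Suc j) (?C ?A)"
      unfolding C by (intro rank_saturated_Int_atom) auto
    then have "card {\<pi> \<in> ?C ?A. \<pi> (Suc j) = k} + W (Suc j) * (real (card ?A) - card (?C ?A))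
        \<le> W j * card ?A"
      using j rel_rank_bounds by (intro step) auto
    then show "(\<Sum>\<sigma>\<in>?A. stage_gain W k \<tau> j \<sigma>) \<le> 0"
      by (simp add: sum_stage_gain)
  qed
  have "(\<Sum>j<n. \<Sum>\<pi>\<in>{\<pi> \<in> rank_perms n. j < \<tau> \<pi>}. stage_gain W k \<tau> j \<pi>) \<le> 0"
    by (rule sum_nonpos) (simp only: lessThan_iff stage)
  moreover have "\<tau> \<in> rank_perms n \<rightarrow> {1..n}"
    using \<tau> by (simp add: stopping_rules_def)
  ultimately show ?thesis
    by (simp only: card_success_telescope[where W = W])
qed

section \<open>Bound for a single stage\<close>

text \<open>Each relative rank met by \<open>C\<close> brings in a whole subatom, a share
  \<open>1 / Suc j\<close> of the atom, and different ranks give disjoint subatoms.\<close>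

lemma saturated_card_ge:
  assumes "j < n" "\<And>i. i \<in> {1..n} \<Longrightarrow> x i \<in> {1..i}" "C \<subseteq> rank_atom n j x"
    "rank_saturated n (Suc j) C" "finite Y"
    and Y: "\<And>y. y \<in> Y \<Longrightarrow> \<exists>\<pi>\<in>C. rel_rank (Suc j) \<pi> = y"
  shows "card Y * card (rank_atom n j x) \<le> Suc j * card C"
proof -
  let ?D = "\<lambda>y. rank_atom n (Suc j) (x(Suc j := y))"
  have fin: "finite C"
    using assms(3) finite_rank_atom finite_subset by blast
  have D: "?D y \<subseteq> C" "Suc j * card (?D y) = card (rank_atom n j x)" if y: "y \<in> Y" for y
  proof -
    obtain \<pi> where \<pi>: "\<pi> \<in> C" "rel_rank (Suc j) \<pi> = y"
      using Y[OF y] by auto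
    have ranks: "rel_rank i \<pi> = (x(Suc j := y)) i" if "i \<in> {1..Suc j}" for i
      using \<pi> assms(3) that by (auto simp: rank_atom_def)
    then have "rank_atom n (Suc j) (\<lambda>i. rel_rank i \<pi>) = ?D y"
      by (simp add: rank_atom_def)
    then show "?D y \<subseteq> C"
      using assms(4) \<pi>(1) unfolding rank_saturated_def by blast
    have "(x(Suc j := y)) i \<in> {1..i}" if "i \<in> {1..Suc j}" for i
      using rel_rank_bounds[of i \<pi>] ranks[OF that] that by auto
    then show "Suc j * card (?D y) = card (rank_atom n j x)"
      using card_rank_atom_Suc[of j n "x(Suc j := y)"] assms(1) by (simp add: rank_atom_upd)
  qed
  have "card Y * card (rank_atom n j x) = (\<Sum>y\<in>Y. Suc j * card (?D y))"
    using D(2) by simp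
  also have "\<dots> = Suc j * card (\<Union>y\<in>Y. ?D y)"
    using assms(5) by (subst card_UN_disjoint) (auto simp: rank_atom_Suc sum_distrib_left)
  also have "\<dots> \<le> Suc j * card C"
    using D(1) fin by (intro mult_le_mono2 card_mono) auto
  finally show ?thesis .
qed

text \<open>Stopping nowhere yields \<open>w\<close>. Otherwise at least a share
  \<open>1 / Suc j\<close> of the continuation value is given up, for a reward of at most the share
  \<open>1 / n\<close>.\<close>

lemma stage_bound:
  fixes v w :: real
  assumes j: "j < n" and x: "\<And>i. i \<in> {1..n} \<Longrightarrow> x i \<in> {1..i}" and C: "C \<subseteq> rank_atom n j x"
    "rank_saturated n (Suc j) C" and k: "k \<in> {1..n}"
    and w: "0 \<le> w" "w + max 0 (1 / n - w / Suc j) \<le> v"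
  shows "card {\<pi> \<in> C. \<pi> (Suc j) = k} + w * (real (card (rank_atom n j x)) - card C)
    \<le> v * card (rank_atom n j x)"
proof (cases "C = {}")
  case True
  then show ?thesis
    using w by (simp add: mult_right_mono)
next
  case False
  let ?A = "rank_atom n j x"
  obtain \<pi> where "\<pi> \<in> C" using False by auto
  then have "1 * card ?A \<le> Suc j * card C"
    using saturated_card_ge[OF j x C, of "{rel_rank (Suc j) \<pi>}"] by auto
  then have "real (card ?A) \<le> Suc j * real (card C)"
    by (metis mult_1 of_nat_le_iff of_nat_mult)
  then have 1: "card ?A / Suc j \<le> card C"
    by (simp add: field_simps)
  have "card {\<pi> \<in> C. \<pi> (Suc j) = k} \<le> card {\<pi> \<in> ?A. \<pi> (Suc j) = k}"
    using C(1) by (intro card_mono) auto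
  moreover have "real n * card {\<pi> \<in> ?A. \<pi> (Suc j) = k} = card ?A"
    using card_rank_atom_value[OF j k, of x] by (simp flip: of_nat_mult)
  then have "card {\<pi> \<in> ?A. \<pi> (Suc j) = k} = card ?A / n"
    using j by (simp add: field_simps)
  ultimately have 2: "card {\<pi> \<in> C. \<pi> (Suc j) = k} \<le> card ?A / n"
    by linarith
  have "card {\<pi> \<in> C. \<pi> (Suc j) = k} + w * (real (card ?A) - card C)
      \<le> card ?A / n + w * (card ?A - card ?A / Suc j)"
    using 1 2 w(1) by (intro add_mono mult_left_mono) auto
  also have "\<dots> = (w + (1 / n - w / Suc j)) * card ?A"
    by (simp add: algebra_simps)
  also have "\<dots> \<le> v * card ?A"
    using w(2) by (intro mult_right_mono) auto
  finally show ?thesis .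
qed

section \<open>The stage with two candidates left\<close>

lemma card_perm_le:
  assumes "\<pi> \<in> rank_perms n" "m \<in> {1..n}"
  shows "card {i \<in> {1..n}. \<pi> i \<le> \<pi> m} = \<pi> m"
proof -
  have p: "\<pi> permutes {1..n}" using assms(1) by (simp add: rank_perms_def)
  have m: "\<pi> m \<in> {1..n}"
    using permutes_in_image[OF p] assms(2) by blast
  have "\<pi> ` {i \<in> {1..n}. \<pi> i \<le> \<pi> m} = {v \<in> \<pi> ` {1..n}. v \<le> \<pi> m}"
    by auto
  also have "\<dots> = {1..\<pi> m}"
    using m unfolding permutes_image[OF p] by auto
  finally have "card (\<pi> ` {i \<in> {1..n}. \<pi> i \<le> \<pi> m}) = \<pi> m"
    by simp
  then show ?thesis
    using permutes_inj[OF p] by (simp add: card_image inj_on_subset)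
qed

text \<open>After the last arrival relative and absolute ranks coincide; the last but one candidate
  can only move up by one, when the last value is smaller.\<close>

lemma last_two_values:
  assumes "\<pi> \<in> rank_perms (Suc m)" "m \<ge> 1"
  shows "rel_rank (Suc m) \<pi> = \<pi> (Suc m)"
    and "\<pi> m = rel_rank m \<pi> + of_bool (\<pi> (Suc m) \<le> \<pi> m)"
proof -
  show "rel_rank (Suc m) \<pi> = \<pi> (Suc m)"
    using card_perm_le[OF assms(1), of "Suc m"] by (simp add: rel_rank_def)
  have "{i \<in> {1..Suc m}. \<pi> i \<le> \<pi> m} =
      {i \<in> {1..m}. \<pi> i \<le> \<pi> m} \<union> (if \<pi> (Suc m) \<le> \<pi> m then {Suc m} else {})"
    by (auto simp: le_Suc_eq)
  then have "card {i \<in> {1..Suc m}. \<pi> i \<le> \<pi> m} = rel_rank m \<pi> + of_bool (\<pi> (Suc m) \<le> \<pi> m)"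
    by (simp add: rel_rank_def)
  then show "\<pi> m = rel_rank m \<pi> + of_bool (\<pi> (Suc m) \<le> \<pi> m)"
    using card_perm_le[OF assms(1), of m] assms(2) by simp
qed

lemma obtain_penultimate_value:
  assumes n: "n = Suc (Suc j)" and k: "1 < k" "k < n" and y: "y \<in> {k - 1, k}"
    and x: "\<And>i. i \<in> {1..n} \<Longrightarrow> x i \<in> {1..i}"
  obtains \<pi> where "\<pi> \<in> rank_atom n j x" "rel_rank (Suc j) \<pi> = y" "\<pi> (Suc j) = k"
proof -
  \<comment> \<open>The last value \<open>n\<close> leaves the relative rank \<open>k\<close>
    unchanged as absolute rank, while the last value \<open>1\<close> lifts \<open>k - 1\<close> to
    \<open>k\<close>.\<close>
  define z where "z = (if y = k then n else 1)"
  let ?x = "x(Suc j := y, Suc (Suc j) := z)"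
  have "card (rank_atom n n ?x) > 0"
    using x k y n by (intro card_rank_atom_pos) (auto simp: z_def)
  then obtain \<pi> where \<pi>: "\<pi> \<in> rank_atom n n ?x"
    by (metis card_gt_0_iff ex_in_conv)
  then have E: "\<pi> \<in> rank_perms (Suc (Suc j))" and p: "\<pi> permutes {1..n}"
    using n by (auto simp: rank_atom_def rank_perms_def)
  have r: "rel_rank (Suc j) \<pi> = y" "rel_rank (Suc (Suc j)) \<pi> = z"
    and atom: "\<pi> \<in> rank_atom n j x"
    using \<pi> n by (auto simp: rank_atom_def)
  have z: "\<pi> (Suc (Suc j)) = z" and v: "\<pi> (Suc j) = y + of_bool (z \<le> \<pi> (Suc j))"
    using last_two_values[OF E] r by simp_all
  have in_n: "\<pi> (Suc j) \<in> {1..n}"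
    using permutes_in_image[OF p, of "Suc j"] n by simp
  have "\<pi> (Suc j) \<noteq> z"
    using z injD[OF permutes_inj[OF p], of "Suc j" "Suc (Suc j)"] by auto
  then have "\<pi> (Suc j) = k"
    using v in_n y k by (auto simp: z_def split: if_splits)
  with atom r show ?thesis using that by blast
qed

text \<open>The target is reachable from both relative ranks \<open>k - 1\<close> and
  \<open>k\<close>. Stopping on both gives up twice the continuation value, missing one of them
  loses reward; either way the generic bound drops by \<open>1 / (n * (n - 1))\<close>.\<close>

lemma penultimate_stage_bound:
  assumes n: "n = Suc (Suc j)" and n3: "n \<ge> 3" and k: "1 < k" "k < n"
    and x: "\<And>i. i \<in> {1..n} \<Longrightarrow> x i \<in> {1..i}"
    and C: "C \<subseteq> rank_atom n j x" "rank_saturated n (Suc j) C"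
  shows "card {\<pi> \<in> C. \<pi> (Suc j) = k} + 1 / n * (real (card (rank_atom n j x)) - card C)
    \<le> (1 / n + (real n - 3) / (n * (real n - 1))) * card (rank_atom n j x)"
proof -
  let ?A = "rank_atom n j x" and ?K = "\<lambda>B. {\<pi> \<in> B. \<pi> (Suc j) = k}"
  have j: "j < n" using n by simp
  have A: "card ?A = Suc j * n"
    using card_rank_atom[of j n x] x n by (simp add: prod.atLeast_Suc_atMost)
  then have AK: "card (?K ?A) = Suc j"
  proof -
    have "n * card (?K ?A) = n * Suc j"
      using card_rank_atom_value[OF j, of k x] k A by (simp only: atLeastAtMost_iff mult.commute) simp
    then show ?thesis
      using n by (simp only: mult_left_cancel)
  qed
  have "card (?K C) \<le> card (?K ?A)"
    using C(1) by (intro card_mono) auto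
  then have KC: "card (?K C) \<le> Suc j"
    using AK by (rule ord_le_eq_trans)
  \<comment> \<open>The claim multiplied by \<open>n\<close>, after inserting
    \<open>card ?A = (n - 1) * n\<close>. For empty \<open>C\<close> it rests on
    \<open>n \<ge> 3\<close>.\<close>
  have "n * card (?K C) + 3 * n \<le> n * n + card C"
  proof (cases "C = {}")
    case True
    then show ?thesis using n3 by simp
  next
    case False
    show ?thesis
    proof (cases "\<forall>y\<in>{k - 1, k}. \<exists>\<pi>\<in>C. rel_rank (Suc j) \<pi> = y")
      case True
      then have "card {k - 1, k} * card ?A \<le> Suc j * card C"
        using saturated_card_ge[OF j x C, of "{k - 1, k}"] by auto
      then have "Suc j * (2 * n) \<le> Suc j * card C"
        using k A by (simp add: algebra_simps)
      then have "2 * n \<le> card C"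
        by (simp only: mult_le_cancel1 zero_less_Suc simp_thms)
      moreover have "n * card (?K C) \<le> n * Suc j"
        using KC by (rule mult_le_mono2)
      ultimately show ?thesis
        using n by simp
    next
      case False2: False
      then obtain y where y: "y \<in> {k - 1, k}" "\<forall>\<pi>\<in>C. rel_rank (Suc j) \<pi> \<noteq> y"
        by auto
      obtain \<pi> where \<pi>: "\<pi> \<in> ?A" "rel_rank (Suc j) \<pi> = y" "\<pi> (Suc j) = k"
        using obtain_penultimate_value[OF n k y(1) x] .
      have "?K C \<subset> ?K ?A"
        using C(1) \<pi> y(2) by blast
      then have "card (?K C) < card (?K ?A)"
        by (intro psubset_card_mono) auto
      then have "card (?K C) \<le> j"
        using AK by simp
      then have 1: "n * card (?K C) \<le> n * j"
        by (rule mult_le_mono2)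
      obtain \<sigma> where \<sigma>: "\<sigma> \<in> C" using False by auto
      then have "card ?A \<le> Suc j * card C"
        using saturated_card_ge[OF j x C, of "{rel_rank (Suc j) \<sigma>}"] by auto
      then have "n \<le> card C"
        unfolding A by (simp only: mult_le_cancel1 zero_less_Suc simp_thms)
      with 1 show ?thesis
        using n by simp
    qed
  qed
  then have "real (n * card (?K C) + 3 * n) \<le> real (n * n + card C)"
    by (simp only: of_nat_le_iff)
  then have "real n * card (?K C) + 3 * real n \<le> real n * real n + card C"
    by simp
  then have "card (?K C) - card C / n \<le> real n - 3"
    using n3 by (simp add: field_simps)
  moreover have "real (card ?A) = n * (real n - 1)"
    using A n by (simp add: algebra_simps)
  then have "(1 / n + (real n - 3) / (n * (real n - 1))) * card ?A = 1 / n * card ?A + (real n - 3)"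
    using n3 by (simp add: distrib_right)
  ultimately show ?thesis
    by (simp add: right_diff_distrib)
qed

section \<open>The value recursion\<close>

text \<open>
  With \<open>d = 0\<close>, the value of the problem for the best candidate when \<open>m\<close> candidates are left;
  \<open>d\<close> is a loss that occurs when the last but one candidate is observed.
\<close>

primrec record_value :: "nat \<Rightarrow> real \<Rightarrow> nat \<Rightarrow> real" where
  "record_value n d 0 = 0"
| "record_value n d (Suc m) =
     record_value n d m + max 0 (1 / n - record_value n d m / (real n - real m)) - (if m = 1 then d else 0)"

lemma record_value_1: "record_value n d (Suc 0) = 1 / n"
  by simp

lemma record_value_nonneg:
  assumes "d \<le> 1 / n"
  shows "0 \<le> record_value n d m"
proof (induction m)
  case (Suc m)
  show ?case
  proof (cases "m = 1")
    case True
    then show ?thesis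
      using assms record_value_1[of n d] max.cobounded1[of 0 "1 / n - 1 / n / (real n - 1)"]
      by (simp del: max.cobounded1)
  next
    case False
    then show ?thesis using Suc by simp
  qed
qed simp

text \<open>The step map is the maximum of \<open>a\<close> and \<open>c + (1 - 1 / q) * a\<close>,
  both strictly increasing in \<open>a\<close> because \<open>q > 1\<close>.\<close>

lemma record_value_step_strict_mono:
  fixes a b q :: real
  assumes "a < b" "1 < q"
  shows "a + max 0 (c - a / q) < b + max 0 (c - b / q)"
proof -
  have "a - a / q < b - b / q"
  proof -
    have "(b - a) / q < b - a"
      using assms mult_strict_left_mono[of 1 q "b - a"] by (simp add: pos_divide_less_eq)
    then show ?thesis by (simp add: diff_divide_distrib)
  qed
  then show ?thesis using assms by (simp add: max_def)
qed

lemma record_value_less: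
  assumes n: "n \<ge> 3" and d: "0 < d"
  shows "record_value n d n < record_value n 0 n"
proof -
  \<comment> \<open>The second conjunct prepares the last step, whose divisor is 1: there both
    values become a maximum with \<open>1 / n\<close>, and the gap survives because the larger value
    exceeds \<open>1 / n\<close>.\<close>
  have gt: "record_value n d m < record_value n 0 m \<and> 1 / n < record_value n 0 m"
    if "2 \<le> m" "m \<le> n - 1" for m
    using that
  proof (induction m rule: dec_induct)
    case base
    have "1 / n / (real n - 1) < 1 / n"
      using n by (simp add: field_simps)
    then show ?case
      using d by (simp add: numeral_2_eq_2)
  next
    case (step m)
    have "record_value n d (Suc m) < record_value n 0 (Suc m)"
      using step record_value_step_strict_mono[of "record_value n d m" "record_value n 0 m" "real n - real m" "1 / n"]
      by simp
    moreover have "record_value n 0 m \<le> record_value n 0 (Suc m)"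
      by simp
    ultimately show ?case using step by linarith
  qed
  have "record_value n d (n - 1) < record_value n 0 (n - 1) \<and> 1 / n < record_value n 0 (n - 1)"
    using n by (intro gt) auto
  moreover obtain m where "n = Suc m" "m \<noteq> 1"
    using n by (cases n) auto
  ultimately show ?thesis
    by (simp add: max_def)
qed

text \<open>Change of index from candidates left to candidates rejected, which turns the divisor
  into \<open>Suc j\<close>.\<close>

lemma record_value_stage:
  assumes "j < n"
  shows "record_value n d (n - j) = record_value n d (n - Suc j)
    + max 0 (1 / n - record_value n d (n - Suc j) / Suc j) - (if n = Suc (Suc j) then d else 0)"
proof -
  have "n - j = Suc (n - Suc j)" "real n - real (n - Suc j) = Suc j" "n - Suc j = 1 \<longleftrightarrow> n = Suc (Suc j)"
    using assms by auto
  then show ?thesis by simp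
qed

section \<open>Upper bounds for all stopping rules\<close>

lemma card_success_le_record_value:
  assumes "\<tau> \<in> stopping_rules n" "k \<in> {1..n}"
  shows "card {\<pi> \<in> rank_perms n. \<pi> (\<tau> \<pi>) = k} \<le> record_value n 0 n * fact n"
proof -
  have "card {\<pi> \<in> rank_perms n. \<pi> (\<tau> \<pi>) = k} \<le> record_value n 0 (n - 0) * fact n"
    using assms(1)
  proof (rule card_success_le)
    fix j x C
    assume *: "j < n" "\<And>i. i \<in> {1..n} \<Longrightarrow> x i \<in> {1..i}" "C \<subseteq> rank_atom n j x" "rank_saturated n (Suc j) C"
    show "card {\<pi> \<in> C. \<pi> (Suc j) = k} + record_value n 0 (n - Suc j) * (real (card (rank_atom n j x)) - card C)
        \<le> record_value n 0 (n - j) * card (rank_atom n j x)"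
      using record_value_stage[OF *(1), of 0]
      by (intro stage_bound * assms(2) record_value_nonneg) auto
  qed
  then show ?thesis by simp
qed

text \<open>The sharper bound enters at the stage with two candidates left; the generic bound serves
  at all other stages.\<close>

lemma card_success_le_penalized:
  fixes n :: nat
  defines "d \<equiv> 1 / (n * (real n - 1))"
  assumes n: "n \<ge> 3" and \<tau>: "\<tau> \<in> stopping_rules n" and k: "1 < k" "k < n"
  shows "card {\<pi> \<in> rank_perms n. \<pi> (\<tau> \<pi>) = k} \<le> record_value n d n * fact n"
proof -
  have "card {\<pi> \<in> rank_perms n. \<pi> (\<tau> \<pi>) = k} \<le> record_value n d (n - 0) * fact n"
    using \<tau>
  proof (rule card_success_le)
    fix j x C
    assume *: "j < n" "\<And>i. i \<in> {1..n} \<Longrightarrow> x i \<in> {1..i}" "C \<subseteq> rank_atom n j x" "rank_saturated n (Suc j) C"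
    show "card {\<pi> \<in> C. \<pi> (Suc j) = k} + record_value n d (n - Suc j) * (real (card (rank_atom n j x)) - card C)
        \<le> record_value n d (n - j) * card (rank_atom n j x)"
    proof (cases "n = Suc (Suc j)")
      case True
      have "1 / n / (real n - 1) \<le> 1 / n"
        using n by (simp add: field_simps)
      then have "record_value n d (n - j) = 1 / n + (1 / n - 1 / n / (real n - 1)) - d"
        using record_value_stage[OF *(1), of d] True by simp
      \<comment> \<open>The rejected share \<open>1 / n / (n - 1)\<close> equals \<open>d\<close>,
        so \<open>d\<close> is subtracted twice.\<close>
      also have "\<dots> = 1 / n + (real n - 3) / (n * (real n - 1))"
      proof -
        have "1 / n = (real n - 1) / (n * (real n - 1))"
          using n by simp
        moreover have "1 / n / (real n - 1) = d"
          by (simp add: d_def)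
        moreover have "(real n - 3) / (n * (real n - 1)) = (real n - 1) / (n * (real n - 1)) - d - d"
          unfolding d_def diff_divide_distrib[symmetric] by simp
        ultimately show ?thesis by linarith
      qed
      finally show ?thesis
        using penultimate_stage_bound[OF True n k *(2-4)] True by simp
    next
      case False
      have "d \<le> 1 / n"
        using n by (simp add: d_def field_simps)
      then show ?thesis
        using record_value_stage[OF *(1), of d] False k
        by (intro stage_bound * record_value_nonneg) auto
    qed
  qed
  then show ?thesis by simp
qed

section \<open>An optimal rule for the extreme ranks\<close>

text \<open>\<open>e j\<close> is meant to be the only relative rank compatible with the target;
  given it, stopping succeeds with probability \<open>j / n\<close>, which the threshold compares
  with the continuation value. The disjunct \<open>j = n\<close> forces a stop at the end and makes
  \<open>LEAST\<close> well defined.\<close>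

definition record_rule :: "nat \<Rightarrow> (nat \<Rightarrow> nat) \<Rightarrow> (nat \<Rightarrow> nat) \<Rightarrow> nat" where
  "record_rule n e \<pi> = (LEAST j. j = n \<or>
     j \<in> {1..n} \<and> record_value n 0 (n - j) / j \<le> 1 / n \<and> rel_rank j \<pi> = e j)"

lemma record_rule_cases:
  "record_rule n e \<pi> = n \<or> record_rule n e \<pi> \<in> {1..n} \<and>
     record_value n 0 (n - record_rule n e \<pi>) / record_rule n e \<pi> \<le> 1 / n \<and>
     rel_rank (record_rule n e \<pi>) \<pi> = e (record_rule n e \<pi>)"
  unfolding record_rule_def by (rule LeastI[of _ n]) simp

lemma record_rule_le:
  assumes "j = n \<or> j \<in> {1..n} \<and> record_value n 0 (n - j) / j \<le> 1 / n \<and> rel_rank j \<pi> = e j"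
  shows "record_rule n e \<pi> \<le> j"
  unfolding record_rule_def using assms by (rule Least_le)

text \<open>For \<open>t < n\<close>, having stopped by \<open>t\<close> is a finite union of
  generating events with indices up to \<open>t\<close>; for larger \<open>t\<close> it is the whole
  space.\<close>

lemma record_rule_stopping:
  assumes "n \<ge> 1"
  shows "record_rule n e \<in> stopping_rules n"
proof -
  have sp: "space (rank_filtration n t) = rank_perms n" for t
    using filtration_rank_filtration by (rule filtration.space_F)
  have "{\<pi> \<in> rank_perms n. record_rule n e \<pi> \<le> t} \<in> sets (rank_filtration n t)" for t
  proof (cases "n \<le> t")
    case True
    then have "{\<pi> \<in> rank_perms n. record_rule n e \<pi> \<le> t} = space (rank_filtration n t)"
      using record_rule_le[of n n] sp by (auto intro: order_trans)
    then show ?thesis by simp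
  next
    case False
    let ?I = "{i \<in> {1..t}. record_value n 0 (n - i) / i \<le> 1 / n}"
    have "{\<pi> \<in> rank_perms n. record_rule n e \<pi> \<le> t} = (\<Union>i\<in>?I. rel_rank i -` {e i} \<inter> rank_perms n)"
    proof (intro equalityI subsetI)
      fix \<pi> assume "\<pi> \<in> {\<pi> \<in> rank_perms n. record_rule n e \<pi> \<le> t}"
      then show "\<pi> \<in> (\<Union>i\<in>?I. rel_rank i -` {e i} \<inter> rank_perms n)"
        using record_rule_cases[of n e \<pi>] False by (intro UN_I[of "record_rule n e \<pi>"]) auto
    next
      fix \<pi> assume "\<pi> \<in> (\<Union>i\<in>?I. rel_rank i -` {e i} \<inter> rank_perms n)"
      then obtain i where i: "i \<in> ?I" "rel_rank i \<pi> = e i" "\<pi> \<in> rank_perms n"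
        by auto
      then have "record_rule n e \<pi> \<le> i"
        using False by (intro record_rule_le) auto
      then show "\<pi> \<in> {\<pi> \<in> rank_perms n. record_rule n e \<pi> \<le> t}"
        using i by auto
    qed
    also have "\<dots> \<in> sets (rank_filtration n t)"
    proof (rule sets.finite_UN)
      fix i assume "i \<in> ?I"
      then show "rel_rank i -` {e i} \<inter> rank_perms n \<in> sets (rank_filtration n t)"
        using False unfolding sets_rank_filtration by (intro sigma_sets.Basic) auto
    qed auto
    finally show ?thesis .
  qed
  moreover have "record_rule n e \<in> rank_perms n \<rightarrow> {1..n}"
  proof
    fix \<pi> show "record_rule n e \<pi> \<in> {1..n}"
      using record_rule_cases[of n e \<pi>] assms by auto
  qed
  ultimately show ?thesis
    unfolding stopping_rules_def stopping_time_def pred_def sp by simp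
qed

text \<open>By \<open>rank_k\<close>, stopping on the single relative rank \<open>e (Suc j)\<close>
  catches every success in the atom at the least possible cost, so the stage bound is
  attained.\<close>

lemma record_rule_success:
  assumes n: "n \<ge> 1" and k: "k \<in> {1..n}"
    and e: "\<And>j. j \<in> {1..n} \<Longrightarrow> e j \<in> {1..j}"
    and rank_k: "\<And>\<pi> j. \<pi> \<in> rank_perms n \<Longrightarrow> j \<in> {1..n} \<Longrightarrow> \<pi> j = k \<Longrightarrow> rel_rank j \<pi> = e j"
  shows "record_value n 0 n * fact n \<le> card {\<pi> \<in> rank_perms n. \<pi> (record_rule n e \<pi>) = k}"
proof -
  let ?\<tau> = "record_rule n e"
  define W where "W = (\<lambda>j. record_value n 0 (n - j))"
  have \<tau>: "?\<tau> \<in> stopping_rules n"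
    using n by (rule record_rule_stopping)
  \<comment> \<open>The sign is reversed so that \<open>sum_saturated_le_0\<close> yields a lower
    bound.\<close>
  have stage: "(\<Sum>\<pi>\<in>{\<pi> \<in> rank_perms n. j < ?\<tau> \<pi>}. - stage_gain W k ?\<tau> j \<pi>) \<le> 0" if j: "j < n" for j
  proof (rule sum_saturated_le_0)
    show sat: "rank_saturated n j {\<pi> \<in> rank_perms n. j < ?\<tau> \<pi>}"
      using \<tau> j by (intro stopping_rule_saturated) auto
    fix \<pi> assume \<pi>: "\<pi> \<in> {\<pi> \<in> rank_perms n. j < ?\<tau> \<pi>}"
    let ?x = "\<lambda>i. rel_rank i \<pi>"
    let ?A = "rank_atom n j ?x"
    let ?C = "{\<sigma> \<in> ?A. ?\<tau> \<sigma> = Suc j}"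
    have later: "j < ?\<tau> \<sigma>" if "\<sigma> \<in> ?A" for \<sigma>
      using sat \<pi> that unfolding rank_saturated_def by blast
    have "real n * card {\<sigma> \<in> ?A. \<sigma> (Suc j) = k} = card ?A"
      using card_rank_atom_value[OF j k, of ?x] by (simp flip: of_nat_mult)
    then have K: "card {\<sigma> \<in> ?A. \<sigma> (Suc j) = k} = card ?A / n"
      using n by (simp add: field_simps)
    have Wj: "W j = W (Suc j) + max 0 (1 / n - W (Suc j) / Suc j)"
      using record_value_stage[OF j, of 0] by (simp add: W_def)
    \<comment> \<open>Three cases: the forced stop at \<open>n\<close>; a profitable stop, where the
      maximum in \<open>Wj\<close> is its second argument; no stop in this atom, where the maximum
      is 0.\<close>
    have "card {\<sigma> \<in> ?C. \<sigma> (Suc j) = k} + W (Suc j) * (real (card ?A) - card ?C) \<ge> W j * card ?A"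
    proof (cases "Suc j = n")
      case True
      have "?\<tau> \<sigma> = Suc j" if "\<sigma> \<in> ?A" for \<sigma>
        using later[OF that] record_rule_le[of n n \<sigma> e] True by simp
      then have "?C = ?A" by blast
      moreover have "W j = 1 / n"
        using Wj True by (simp add: W_def)
      ultimately show ?thesis using K by simp
    next
      case False
      show ?thesis
      proof (cases "W (Suc j) / Suc j \<le> 1 / n")
        case True
        have "?\<tau> \<sigma> = Suc j \<longleftrightarrow> rel_rank (Suc j) \<sigma> = e (Suc j)" if "\<sigma> \<in> ?A" for \<sigma>
          using later[OF that] record_rule_cases[of n e \<sigma>] record_rule_le[of "Suc j" n \<sigma> e] False True j
          by (auto simp: W_def)
        then have C: "?C = {\<sigma> \<in> ?A. rel_rank (Suc j) \<sigma> = e (Suc j)}"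
          by blast
        also have "\<dots> = rank_atom n (Suc j) (?x(Suc j := e (Suc j)))"
          by (simp add: rank_atom_Suc rank_atom_upd)
        finally have "Suc j * card ?C = card ?A"
          using card_rank_atom_Suc[of j n "?x(Suc j := e (Suc j))"] j e[of "Suc j"] rel_rank_bounds
          by (simp add: rank_atom_upd)
        then have "real (Suc j) * card ?C = card ?A"
          by (simp only: of_nat_mult[symmetric])
        then have cC: "card ?C = card ?A / Suc j"
          by (simp add: field_simps)
        have CK: "{\<sigma> \<in> ?C. \<sigma> (Suc j) = k} = {\<sigma> \<in> ?A. \<sigma> (Suc j) = k}"
          unfolding C using rank_k[of _ "Suc j"] j by (auto simp: rank_atom_def)
        have "W j = W (Suc j) + (1 / n - W (Suc j) / Suc j)"
          using Wj True by simp
        then have "W j * card ?A = card ?A / n + W (Suc j) * (card ?A - card ?A / Suc j)"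
          by (simp add: distrib_right right_diff_distrib left_diff_distrib)
        then show ?thesis
          unfolding CK cC K by (rule eq_refl)
      next
        case False2: False
        have "?\<tau> \<sigma> \<noteq> Suc j" if "\<sigma> \<in> ?A" for \<sigma>
          using record_rule_cases[of n e \<sigma>] False False2 by (auto simp: W_def)
        then have C: "?C = {}" by blast
        have "W j = W (Suc j)"
          using Wj False2 by simp
        then show ?thesis unfolding C by simp
      qed
    qed
    then have "(\<Sum>\<sigma>\<in>?A. stage_gain W k ?\<tau> j \<sigma>) \<ge> 0"
      by (simp add: sum_stage_gain)
    then show "(\<Sum>\<sigma>\<in>?A. - stage_gain W k ?\<tau> j \<sigma>) \<le> 0"
      by (simp add: sum_negf)
  qed
  have "(\<Sum>j<n. \<Sum>\<pi>\<in>{\<pi> \<in> rank_perms n. j < ?\<tau> \<pi>}. stage_gain W k ?\<tau> j \<pi>) \<ge> 0"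
  proof (rule sum_nonneg)
    fix j assume "j \<in> {..<n}"
    then show "(\<Sum>\<pi>\<in>{\<pi> \<in> rank_perms n. j < ?\<tau> \<pi>}. stage_gain W k ?\<tau> j \<pi>) \<ge> 0"
      using stage[of j] by (simp add: sum_negf)
  qed
  moreover have "?\<tau> \<in> rank_perms n \<rightarrow> {1..n}"
    using \<tau> by (simp add: stopping_rules_def)
  moreover have "W 0 = record_value n 0 n"
    by (simp add: W_def)
  ultimately show ?thesis
    by (simp only: card_success_telescope[where W = W])
qed

section \<open>From counts to selection probabilities\<close>

lemma measure_success:
  "measure (rank_measure n) {\<pi> \<in> space (rank_measure n). \<pi> (\<tau> \<pi>) = k} =
     card {\<pi> \<in> rank_perms n. \<pi> (\<tau> \<pi>) = k} / fact n"
proof -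
  have "card (rank_perms n) = fact n"
    unfolding rank_perms_def by (rule card_permutations) auto
  then show ?thesis
    unfolding rank_measure_def space_uniform_count_measure
    by (subst measure_uniform_count_measure) (auto simp: finite_rank_perms)
qed

lemma select_prob_le:
  fixes c :: real
  assumes "n \<ge> 1"
    and "\<And>\<tau>. \<tau> \<in> stopping_rules n \<Longrightarrow> card {\<pi> \<in> rank_perms n. \<pi> (\<tau> \<pi>) = k} \<le> c * fact n"
  shows "select_prob k n \<le> c"
  unfolding select_prob_def
proof (rule cSUP_least)
  show "stopping_rules n \<noteq> {}"
    using assms(1) by (rule stopping_rules_nonempty)
  show "measure (rank_measure n) {\<pi> \<in> space (rank_measure n). \<pi> (\<tau> \<pi>) = k} \<le> c"
    if "\<tau> \<in> stopping_rules n" for \<tau>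
    unfolding measure_success using assms(2)[OF that] by (simp add: pos_divide_le_eq)
qed

text \<open>The bound valid for every target rank is attained by the record rule as soon as the
  target determines the relative rank.\<close>

lemma select_prob_record:
  assumes n: "n \<ge> 1" and k: "k \<in> {1..n}"
    and e: "\<And>j. j \<in> {1..n} \<Longrightarrow> e j \<in> {1..j}"
    and rank_k: "\<And>\<pi> j. \<pi> \<in> rank_perms n \<Longrightarrow> j \<in> {1..n} \<Longrightarrow> \<pi> j = k \<Longrightarrow> rel_rank j \<pi> = e j"
  shows "select_prob k n = record_value n 0 n"
proof (rule antisym)
  show "select_prob k n \<le> record_value n 0 n"
    using n card_success_le_record_value[OF _ k] by (rule select_prob_le)
  have "record_value n 0 n \<le> card {\<pi> \<in> rank_perms n. \<pi> (record_rule n e \<pi>) = k} / fact n"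
    using record_rule_success[OF n k e rank_k] by (simp only: pos_le_divide_eq fact_gt_zero)
  also have "\<dots> \<le> select_prob k n"
    unfolding select_prob_def measure_success[symmetric]
    using record_rule_stopping[OF n] bdd_above_select_prob by (rule cSUP_upper)
  finally show "record_value n 0 n \<le> select_prob k n" .
qed

theorem theorem3p1:
  fixes n k :: nat
  assumes "n \<ge> 3" and "1 < k" and "k < n"
  shows "select_prob 1 n = select_prob n n \<and> select_prob n n > select_prob k n"
proof -
  have range: "\<pi> i \<in> {1..n}" if "\<pi> \<in> rank_perms n" "i \<in> {1..n}" for \<pi> i
    using that permutes_in_image[of \<pi> "{1..n}" i] by (simp add: rank_perms_def)
  have best: "select_prob 1 n = record_value n 0 n"
  proof (rule select_prob_record[where e = "\<lambda>j. 1"])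
    fix \<pi> j assume \<pi>: "\<pi> \<in> rank_perms n" "j \<in> {1..n}" "\<pi> j = 1"
    have "inj \<pi>" using \<pi>(1) permutes_inj by (auto simp: rank_perms_def)
    then have "i = j" if "i \<in> {1..j}" "\<pi> i \<le> \<pi> j" for i
      using range[OF \<pi>(1), of i] that \<pi> by (intro injD[of \<pi> i j]) auto
    then have "{i \<in> {1..j}. \<pi> i \<le> \<pi> j} = {j}"
      using \<pi>(2) by auto
    then show "rel_rank j \<pi> = 1"
      by (simp add: rel_rank_def)
  qed (use assms in auto)
  have worst: "select_prob n n = record_value n 0 n"
  proof (rule select_prob_record[where e = "\<lambda>j. j"])
    fix \<pi> j assume \<pi>: "\<pi> \<in> rank_perms n" "j \<in> {1..n}" "\<pi> j = n"
    have "\<pi> i \<le> \<pi> j" if "i \<in> {1..j}" for i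
      using range[OF \<pi>(1), of i] \<pi> that by simp
    then have "{i \<in> {1..j}. \<pi> i \<le> \<pi> j} = {1..j}"
      by blast
    then show "rel_rank j \<pi> = j"
      by (simp add: rel_rank_def)
  qed (use assms in auto)
  let ?d = "1 / (n * (real n - 1))"
  have "select_prob k n \<le> record_value n ?d n"
    using assms(1) card_success_le_penalized[OF assms(1) _ assms(2,3)] by (intro select_prob_le) simp_all
  also have "\<dots> < record_value n 0 n"
    using assms by (intro record_value_less) auto
  finally show ?thesis
    using best worst by simp
qed

end
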